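(* (Internal Banach Fixed-Point Theorem.) For every object $X$ of $\mathcal{S}$, the formula $\forall f:X^X.\ \big((\exists x:X.\top)\wedge\mathrm{Contr}(f)\big)\to\exists!x:X.\ f(x)=x$ holds in the internal logic of $\mathcal{S}$.
   Context: $\mathcal{S}$ is the topos of presheaves on $\omega=\{1,2,\dots\}$ with subobject classifier $\Omega$, $\Omega(n)=\{0,\dots,n\}$, and $\rhd:\Omega\to\Omega$ mapping $k\in\Omega(m)$ to $\min(m,k+1)$. The internal logic is the standard Kripke–Joyal forcing semantics of the topos (a formula holds if it is forced at every stage $n$). For $f:X^X$ (more generally $f:Y^X$), the predicate $\mathrm{Contr}(f)$ is defined internally by $\mathrm{Contr}(f)\Leftrightarrow\forall x,x':X.\ \rhd(x=x')\to f(x)=f(x')$. *)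

theory Defs
  imports Main "HOL-Library.FuncSet"
begin

text \<open>
  Objects of the topos of trees: presheaves on \<open>\<omega> = {1, 2, \<dots>}\<close>. Stages are natural numbers
  \<open>n \<ge> 1\<close>; whatever a record contains at stage 0 is ignored throughout. The set at stage \<open>n\<close> is
  \<open>El X n\<close>, and \<open>res X n m\<close> is the restriction from stage \<open>n\<close> to stage \<open>m \<le> n\<close>.
\<close>

record 'a obj =
  El :: "nat \<Rightarrow> 'a set"
  res :: "nat \<Rightarrow> nat \<Rightarrow> 'a \<Rightarrow> 'a"

definition presheaf :: "'a obj \<Rightarrow> bool" where
  "presheaf X \<longleftrightarrow>
     (\<forall>n m. 1 \<le> m \<and> m \<le> n \<longrightarrow> res X n m \<in> El X n \<rightarrow> El X m) \<and>
     (\<forall>n. 1 \<le> n \<longrightarrow> (\<forall>x\<in>El X n. res X n n x = x)) \<and>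
     (\<forall>n m l. 1 \<le> l \<and> l \<le> m \<and> m \<le> n \<longrightarrow>
        (\<forall>x\<in>El X n. res X m l (res X n m x) = res X n l x))"

text \<open>
  The exponential \<open>Y\<^sup>X\<close>: an element at stage \<open>n\<close> is a natural transformation from
  \<open>y(n) \<times> X\<close> to \<open>Y\<close>, that is, a family of maps \<open>f i : X(i) \<rightarrow> Y(i)\<close> for \<open>1 \<le> i \<le> n\<close> commuting with
  restrictions. The extensional function spaces make equality of elements the equality of such
  families; restriction truncates the family.
\<close>

definition exponential :: "'b obj \<Rightarrow> 'a obj \<Rightarrow> (nat \<Rightarrow> 'a \<Rightarrow> 'b) obj" where
  "exponential Y X =
     \<lparr> El = (\<lambda>n. {f \<in> (\<Pi>\<^sub>E i\<in>{1..n}. El X i \<rightarrow>\<^sub>E El Y i).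
                   \<forall>i j. 1 \<le> j \<and> j \<le> i \<and> i \<le> n \<longrightarrow>
                     (\<forall>x\<in>El X i. res Y i j (f i x) = f j (res X i j x))}),
       res = (\<lambda>n m f. restrict f {1..m}) \<rparr>"

text \<open>The subobject classifier and the morphism \<open>\<rhd> : \<Omega> \<rightarrow> \<Omega>\<close>.\<close>

definition Omega :: "nat obj" where
  "Omega = \<lparr> El = (\<lambda>n. {0..n}), res = (\<lambda>n m k. min m k) \<rparr>"

definition later_map :: "nat \<Rightarrow> nat \<Rightarrow> nat" where
  "later_map m k = min m (k + 1)"

text \<open>
  Kripke--Joyal semantics, as a shallow embedding. A term of type \<open>X\<close>, evaluated in an environment
  at stage \<open>n\<close>, is given by the family of its values at the stages \<open>k \<le> n\<close> (in the restricted
  environment); a formula is given by the set of stages \<open>k \<le> n\<close> which force it (again in the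
  restricted environment), so \<open>\<phi> k\<close> reads ``\<open>k\<close> forces \<open>\<phi>\<close>''. A variable bound to
  \<open>a \<in> X(n)\<close> is the family \<open>gen X n a\<close> of the restrictions of \<open>a\<close>.
\<close>

type_synonym 'a trm = "nat \<Rightarrow> 'a"
type_synonym formula = "nat \<Rightarrow> bool"

definition gen :: "'a obj \<Rightarrow> nat \<Rightarrow> 'a \<Rightarrow> 'a trm" where
  "gen X n a = (\<lambda>k. res X n k a)"

definition eval :: "(nat \<Rightarrow> 'a \<Rightarrow> 'b) trm \<Rightarrow> 'a trm \<Rightarrow> 'b trm"  (infixl "\<^bold>\<cdot>" 90) where
  "f \<^bold>\<cdot> x = (\<lambda>n. f n n (x n))"

definition Eq :: "'a trm \<Rightarrow> 'a trm \<Rightarrow> formula"  (infix "\<^bold>=" 50) where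
  "(s \<^bold>= t) = (\<lambda>n. s n = t n)"

definition Top :: formula  ("\<^bold>\<top>") where
  "\<^bold>\<top> = (\<lambda>n. True)"

definition And :: "formula \<Rightarrow> formula \<Rightarrow> formula"  (infixr "\<^bold>\<and>" 35) where
  "(\<phi> \<^bold>\<and> \<psi>) = (\<lambda>n. \<phi> n \<and> \<psi> n)"

definition Imp :: "formula \<Rightarrow> formula \<Rightarrow> formula"  (infixr "\<^bold>\<longrightarrow>" 25) where
  "(\<phi> \<^bold>\<longrightarrow> \<psi>) = (\<lambda>n. \<forall>k. 1 \<le> k \<and> k \<le> n \<longrightarrow> \<phi> k \<longrightarrow> \<psi> k)"

definition Forall :: "'a obj \<Rightarrow> ('a trm \<Rightarrow> formula) \<Rightarrow> formula" where
  "Forall X \<phi> = (\<lambda>n. \<forall>k. 1 \<le> k \<and> k \<le> n \<longrightarrow> (\<forall>a\<in>El X k. \<phi> (gen X k a) k))"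

definition Exists :: "'a obj \<Rightarrow> ('a trm \<Rightarrow> formula) \<Rightarrow> formula" where
  "Exists X \<phi> = (\<lambda>n. \<exists>a\<in>El X n. \<phi> (gen X n a) n)"

definition ExistsUnique :: "'a obj \<Rightarrow> ('a trm \<Rightarrow> formula) \<Rightarrow> formula" where
  "ExistsUnique X \<phi> = Exists X (\<lambda>x. \<phi> x \<^bold>\<and> Forall X (\<lambda>y. \<phi> y \<^bold>\<longrightarrow> (y \<^bold>= x)))"

text \<open>
  The truth value in \<open>\<Omega>(n)\<close> of a formula: the largest stage \<open>k \<le> n\<close> forcing it, or 0 if there is
  none. A formula is forced at \<open>n\<close> iff its truth value is the top element \<open>n\<close> of \<open>\<Omega>(n)\<close>.
\<close>

definition truth_value :: "formula \<Rightarrow> nat trm" where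
  "truth_value \<phi> = (\<lambda>n. Max (insert 0 {k. 1 \<le> k \<and> k \<le> n \<and> \<phi> k}))"

definition Later :: "formula \<Rightarrow> formula"  ("\<^bold>\<rhd> _" [60] 60) where
  "(\<^bold>\<rhd> \<phi>) = (\<lambda>n. later_map n (truth_value \<phi> n) = n)"

definition Contr :: "'a obj \<Rightarrow> (nat \<Rightarrow> 'a \<Rightarrow> 'b) trm \<Rightarrow> formula" where
  "Contr X f = Forall X (\<lambda>x. Forall X (\<lambda>x'. \<^bold>\<rhd> (x \<^bold>= x') \<^bold>\<longrightarrow> (f \<^bold>\<cdot> x \<^bold>= f \<^bold>\<cdot> x')))"

definition holds :: "formula \<Rightarrow> bool" where
  "holds \<phi> \<longleftrightarrow> (\<forall>n. 1 \<le> n \<longrightarrow> \<phi> n)"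

text \<open>
  \<open>\<Omega>\<close> and \<open>Y\<^sup>X\<close> are objects, \<open>\<rhd>\<close> is a morphism, and \<open>\<^bold>\<rhd>\<close> satisfies the usual forcing clause on
  formulas closed under restriction.
\<close>

lemma presheaf_Omega: "presheaf Omega"
  by (auto simp: presheaf_def Omega_def min_def)

lemma later_map_natural:
  assumes "m \<le> n" "k \<in> El Omega n"
  shows "later_map n k \<in> El Omega n"
    and "later_map m (res Omega n m k) = res Omega n m (later_map n k)"
  using assms by (auto simp: Omega_def later_map_def min_def)

lemma presheaf_exponential:
  assumes "presheaf X" "presheaf Y"
  shows "presheaf (exponential Y X)"
  unfolding presheaf_def
proof (intro conjI allI impI ballI)
  fix n m :: nat assume m: "1 \<le> m \<and> m \<le> n"
  show "res (exponential Y X) n m \<in> El (exponential Y X) n \<rightarrow> El (exponential Y X) m"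
  proof
    fix f assume f: "f \<in> El (exponential Y X) n"
    have "restrict f {1..m} \<in> (\<Pi>\<^sub>E i\<in>{1..m}. El X i \<rightarrow>\<^sub>E El Y i)"
      using f m by (auto simp: exponential_def intro!: restrict_PiE_iff[THEN iffD2] dest: PiE_mem)
    with f m show "res (exponential Y X) n m f \<in> El (exponential Y X) m"
      by (simp add: exponential_def)
  qed
next
  fix n f assume "1 \<le> n" and f: "f \<in> El (exponential Y X) n"
  then show "res (exponential Y X) n n f = f"
    by (auto simp: exponential_def PiE_restrict)
next
  fix n m l f
  assume "1 \<le> l \<and> l \<le> m \<and> m \<le> n" "f \<in> El (exponential Y X) n"
  then show "res (exponential Y X) m l (res (exponential Y X) n m f) = res (exponential Y X) n l f"
    by (auto simp: exponential_def restrict_def fun_eq_iff)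
qed

lemma truth_value_in_Omega: "truth_value \<phi> n \<in> El Omega n"
  by (auto simp: truth_value_def Omega_def)

lemma forced_iff_truth_value:
  assumes "1 \<le> n"
  shows "\<phi> n \<longleftrightarrow> truth_value \<phi> n = n"
proof -
  let ?S = "insert 0 {k. 1 \<le> k \<and> k \<le> n \<and> \<phi> k}"
  have fin: "finite ?S" by simp
  have "Max ?S = n \<longleftrightarrow> n \<in> ?S \<and> (\<forall>k\<in>?S. k \<le> n)"
    using fin by (subst Max_eq_iff) auto
  with assms show ?thesis by (auto simp: truth_value_def)
qed

lemma Later_forced:
  assumes mono: "\<And>m k. 1 \<le> k \<Longrightarrow> k \<le> m \<Longrightarrow> \<phi> m \<Longrightarrow> \<phi> k" and n: "1 \<le> n"
  shows "(\<^bold>\<rhd> \<phi>) n \<longleftrightarrow> n = 1 \<or> \<phi> (n - 1)"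
proof -
  let ?S = "insert 0 {k. 1 \<le> k \<and> k \<le> n \<and> \<phi> k}"
  have fin: "finite ?S" by simp
  have "(\<^bold>\<rhd> \<phi>) n \<longleftrightarrow> n - 1 \<le> Max ?S"
    using n by (auto simp: Later_def later_map_def truth_value_def min_def)
  also have "\<dots> \<longleftrightarrow> (\<exists>k\<in>?S. n - 1 \<le> k)"
    using fin by (subst Max_ge_iff) auto
  also have "\<dots> \<longleftrightarrow> n = 1 \<or> \<phi> (n - 1)"
  proof
    assume "\<exists>k\<in>?S. n - 1 \<le> k"
    then obtain k where "k \<in> ?S" "n - 1 \<le> k" by blast
    then show "n = 1 \<or> \<phi> (n - 1)" using n mono[of "n - 1" k] by (cases "n = 1") auto
  next
    assume "n = 1 \<or> \<phi> (n - 1)"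
    then have "n - 1 \<in> ?S" using n by (cases "n = 1") auto
    then show "\<exists>k\<in>?S. n - 1 \<le> k" by blast
  qed
  finally show ?thesis .
qed

end

theory Submission
  imports Defs
begin

text \<open>
  Internal contractiveness says that \<open>f i\<close> depends only on the restriction of its argument to stage
  \<open>i - 1\<close>, and on nothing at all for \<open>i = 1\<close>. Hence fixed points are unique by induction on the
  stage. For existence, start from an element \<open>a\<close> of \<open>X(n)\<close>; each application of \<open>f n\<close> increases
  by one the stage up to which the restriction of the iterate is a fixed point. Working with
  elements of \<open>X(n)\<close> throughout is essential, as restrictions need not be surjective.
\<close>

lemma presheaf_res_in:
  "\<lbrakk>presheaf X; 1 \<le> m; m \<le> n; x \<in> El X n\<rbrakk> \<Longrightarrow> res X n m x \<in> El X m"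
  by (auto simp: presheaf_def)

lemma presheaf_res_id:
  "\<lbrakk>presheaf X; 1 \<le> n; x \<in> El X n\<rbrakk> \<Longrightarrow> res X n n x = x"
  by (auto simp: presheaf_def)

lemma presheaf_res_res:
  "\<lbrakk>presheaf X; 1 \<le> l; l \<le> m; m \<le> n; x \<in> El X n\<rbrakk> \<Longrightarrow> res X m l (res X n m x) = res X n l x"
  by (simp add: presheaf_def)

lemma exponential_app_in:
  "\<lbrakk>f \<in> El (exponential Y X) n; 1 \<le> i; i \<le> n; x \<in> El X i\<rbrakk> \<Longrightarrow> f i x \<in> El Y i"
  by (force simp: exponential_def PiE_iff)

lemma exponential_natural:
  "\<lbrakk>f \<in> El (exponential Y X) n; 1 \<le> j; j \<le> i; i \<le> n; x \<in> El X i\<rbrakk>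
    \<Longrightarrow> res Y i j (f i x) = f j (res X i j x)"
  by (simp add: exponential_def)

lemma eval_gen_exponential:
  "1 \<le> i \<Longrightarrow> (gen (exponential Y X) n f \<^bold>\<cdot> t) i = f i (t i)"
  by (simp add: eval_def gen_def exponential_def)

text \<open>The truth value is a maximum over a set containing \<open>n - 1\<close>, either as a
  forcing stage or as the inserted 0, and \<open>later_map\<close> lifts any value from
  \<open>n - 1\<close> upwards to \<open>n\<close>.\<close>

lemma Later_intro:
  assumes "1 \<le> n" "n = 1 \<or> \<phi> (n - 1)"
  shows "(\<^bold>\<rhd> \<phi>) n"
proof -
  have "n - 1 \<le> truth_value \<phi> n"
    unfolding truth_value_def using assms by (intro Max_ge) auto
  with assms(1) show ?thesis
    by (auto simp: Later_def later_map_def)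
qed

text \<open>External form of \<open>Contr\<close> forced at \<open>m\<close>. Stage 0 carries no
  data, so \<open>i = 1\<close> has its own disjunct, which makes \<open>f 1\<close> constant on
  \<open>El X 1\<close>.\<close>

definition contractive_upto :: "'a obj \<Rightarrow> (nat \<Rightarrow> 'a \<Rightarrow> 'b) \<Rightarrow> nat \<Rightarrow> bool" where
  "contractive_upto X f m \<longleftrightarrow>
     (\<forall>i u v. 1 \<le> i \<and> i \<le> m \<and> u \<in> El X i \<and> v \<in> El X i \<and>
        (i = 1 \<or> res X i (i - 1) u = res X i (i - 1) v) \<longrightarrow> f i u = f i v)"

lemma contractive_uptoD:
  "\<lbrakk>contractive_upto X f m; 1 \<le> i; i \<le> m; u \<in> El X i; v \<in> El X i;
    i = 1 \<or> res X i (i - 1) u = res X i (i - 1) v\<rbrakk> \<Longrightarrow> f i u = f i v"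
  unfolding contractive_upto_def by blast

text \<open>Both quantifiers of \<open>Contr\<close> are instantiated at the same stage
  \<open>i\<close>, where \<open>gen X i u\<close> and \<open>gen X i v\<close> take the values
  \<open>u\<close> and \<open>v\<close>.\<close>

lemma Contr_imp_contractive_upto:
  assumes X: "presheaf X" and contr: "Contr X (gen (exponential Y X) n f) m"
  shows "contractive_upto X f m"
  unfolding contractive_upto_def
proof (intro allI impI, elim conjE)
  fix i u v
  assume i: "1 \<le> i" "i \<le> m" and u: "u \<in> El X i" and v: "v \<in> El X i"
    and eq: "i = 1 \<or> res X i (i - 1) u = res X i (i - 1) v"
  let ?F = "gen (exponential Y X) n f"
  have "(\<^bold>\<rhd> (gen X i u \<^bold>= gen X i v) \<^bold>\<longrightarrow> (?F \<^bold>\<cdot> gen X i u \<^bold>= ?F \<^bold>\<cdot> gen X i v)) i"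
    using contr i u v unfolding Contr_def Forall_def by blast
  moreover have "(\<^bold>\<rhd> (gen X i u \<^bold>= gen X i v)) i"
    using i(1) eq by (intro Later_intro) (auto simp: Eq_def gen_def)
  ultimately have "(?F \<^bold>\<cdot> gen X i u \<^bold>= ?F \<^bold>\<cdot> gen X i v) i"
    using i(1) by (auto simp: Imp_def)
  then show "f i u = f i v"
    using i(1) u v by (simp add: Eq_def eval_gen_exponential gen_def[of X] presheaf_res_id[OF X])
qed

text \<open>By naturality a fixed point restricts to a fixed point one stage down. The induction
  hypothesis identifies the two restrictions, and contractiveness then identifies the images, which
  are the points themselves.\<close>

lemma contractive_fixpoint_unique:
  assumes X: "presheaf X" and f: "f \<in> El (exponential X X) n"
    and contr: "contractive_upto X f m" and m: "m \<le> n"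
    and "1 \<le> i" "i \<le> m" "u \<in> El X i" "v \<in> El X i" "f i u = u" "f i v = v"
  shows "u = v"
  using assms(5-)
proof (induction i arbitrary: u v rule: nat_induct_at_least)
  case base
  then show ?case using contractive_uptoD[OF contr, of 1 u v] by simp
next
  case (Suc i)
  have "res X (Suc i) i u = res X (Suc i) i v"
  proof (rule Suc.IH)
    show "f i (res X (Suc i) i u) = res X (Suc i) i u"
      using exponential_natural[OF f, of i "Suc i" u] Suc.hyps Suc.prems m by simp
    show "f i (res X (Suc i) i v) = res X (Suc i) i v"
      using exponential_natural[OF f, of i "Suc i" v] Suc.hyps Suc.prems m by simp
    show "res X (Suc i) i u \<in> El X i" "res X (Suc i) i v \<in> El X i"
      using Suc.hyps Suc.prems by (auto intro!: presheaf_res_in[OF X])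
  qed (use Suc.prems in simp)
  then have "f (Suc i) u = f (Suc i) v"
    using Suc.prems by (intro contractive_uptoD[OF contr]) auto
  with Suc.prems show ?case by metis
qed

lemma contractive_fixpoint_exists:
  assumes X: "presheaf X" and f: "f \<in> El (exponential X X) n"
    and contr: "contractive_upto X f m"
    and m: "1 \<le> m" "m \<le> n" and a: "a \<in> El X m"
  shows "\<exists>x\<in>El X m. f m x = x"
proof -
  have "\<exists>x\<in>El X m. f i (res X m i x) = res X m i x" if "1 \<le> i" "i \<le> m" for i
    using that
  proof (induction i rule: nat_induct_at_least)
    case base
    have a1: "res X m 1 a \<in> El X 1" by (rule presheaf_res_in[OF X _ m(1) a]) simp
    \<comment> \<open>The first witness is \<open>f m a\<close>: its restriction to stage 1 is a
      value of the constant map \<open>f 1\<close>, hence fixed.\<close>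
    have "f 1 (f 1 (res X m 1 a)) = f 1 (res X m 1 a)"
      using a1 exponential_app_in[OF f _ _ a1] m by (intro contractive_uptoD[OF contr]) auto
    moreover have "res X m 1 (f m a) = f 1 (res X m 1 a)"
      using exponential_natural[OF f _ _ m(2) a] m by simp
    ultimately show ?case
      using exponential_app_in[OF f m a] by metis
  next
    case (Suc i)
    then obtain x where x: "x \<in> El X m" and fix_i: "f i (res X m i x) = res X m i x" by auto
    \<comment> \<open>The next witness is \<open>f m x\<close>, which restricts to
      \<open>f (Suc i) ?u\<close>. This agrees with \<open>?u\<close> at stage \<open>i\<close>, so
      \<open>f (Suc i)\<close> sends both to the same point.\<close>
    let ?u = "res X m (Suc i) x"
    have u: "?u \<in> El X (Suc i)" using presheaf_res_in[OF X _ Suc.prems x] by simp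
    have fu: "f (Suc i) ?u \<in> El X (Suc i)"
      using exponential_app_in[OF f _ _ u] Suc.prems m by simp
    have "res X (Suc i) i (f (Suc i) ?u) = f i (res X (Suc i) i ?u)"
      using exponential_natural[OF f _ _ _ u] Suc.hyps Suc.prems m by simp
    moreover have "res X (Suc i) i ?u = res X m i x"
      using presheaf_res_res[OF X _ _ Suc.prems x] Suc.hyps by simp
    ultimately have "res X (Suc i) i (f (Suc i) ?u) = res X (Suc i) i ?u"
      using fix_i by simp
    then have "f (Suc i) (f (Suc i) ?u) = f (Suc i) ?u"
      using u fu Suc.prems by (intro contractive_uptoD[OF contr]) auto
    moreover have "res X m (Suc i) (f m x) = f (Suc i) ?u"
      using exponential_natural[OF f _ _ m(2) x] Suc.prems by simp
    ultimately show ?case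
      using exponential_app_in[OF f m x] by metis
  qed
  from this[OF m(1)] show ?thesis
    using presheaf_res_id[OF X m(1)] by auto
qed

theorem theorem2p9:
  fixes X :: "'a obj"
  assumes "presheaf X"
  shows "holds (Forall (exponential X X) (\<lambda>f.
           (Exists X (\<lambda>x. \<^bold>\<top>) \<^bold>\<and> Contr X f) \<^bold>\<longrightarrow> ExistsUnique X (\<lambda>x. f \<^bold>\<cdot> x \<^bold>= x)))"
proof -
  note X = assms
  \<comment> \<open>The quantifier introduces \<open>f\<close> at stage \<open>n\<close>; the
    implication then descends to \<open>m \<le> n\<close>, and only there are \<open>a\<close> and
    contractiveness given.\<close>
  have "ExistsUnique X (\<lambda>x. gen (exponential X X) n f \<^bold>\<cdot> x \<^bold>= x) m"
    if f: "f \<in> El (exponential X X) n" and m: "1 \<le> m" "m \<le> n" and a: "a \<in> El X m"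
      and contr: "Contr X (gen (exponential X X) n f) m" for n m f a
  proof -
    note contr_f = Contr_imp_contractive_upto[OF X contr]
    obtain x where x: "x \<in> El X m" and fx: "f m x = x"
      using contractive_fixpoint_exists[OF X f contr_f m a] by blast
    \<comment> \<open>The uniqueness clause descends twice: to \<open>k\<close> for the competitor
      \<open>y\<close>, then to \<open>i\<close> for the implication. So \<open>y\<close> and
      \<open>x\<close> are compared through their restrictions to \<open>i\<close>.\<close>
    have "res X k i y = res X m i x"
      if k: "1 \<le> k" "k \<le> m" and y: "y \<in> El X k" and i: "1 \<le> i" "i \<le> k"
        and fy: "f i (res X k i y) = res X k i y" for k i y
    proof (rule contractive_fixpoint_unique[OF X f contr_f m(2)])
      show "f i (res X m i x) = res X m i x"
        using exponential_natural[OF f i(1) _ m(2) x] fx i k by simp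
      show "res X k i y \<in> El X i" "res X m i x \<in> El X i"
        using i k m x y by (auto intro!: presheaf_res_in[OF X])
    qed (use i k fy in auto)
    with x fx m(1) show ?thesis
      unfolding ExistsUnique_def Exists_def And_def Forall_def Imp_def Eq_def
      by (intro bexI[of _ x]) (auto simp: eval_gen_exponential gen_def[of X] presheaf_res_id[OF X])
  qed
  then show ?thesis
    unfolding holds_def Forall_def Imp_def And_def Exists_def by blast
qed

end
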